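(* Let $H$ be an abelian generalized subgroup of a non-abelian generalized group $G$ and let $A=H\times G$. For $(h_1,g_1),(h_2,g_2)\in A$, define $$(h_1,g_1)\circ(h_2,g_2)=(h_1h_2,\;h_2g_1h_2^{-1}g_2).$$ Then $(A,\circ)$ is a Bol groupoid.
   Context: A generalized group is a non-empty set $G$ with a binary operation (written multiplicatively) such that: (i) $(xy)z=x(yz)$ for all $x,y,z\in G$; (ii) for each $x\in G$ there exists a unique element $e(x)\in G$ such that $xe(x)=e(x)x=x$; (iii) for each $x\in G$ there exists $x^{-1}\in G$ such that $xx^{-1}=x^{-1}x=e(x)$. In a generalized group, the element $x^{-1}$ in (iii) is unique for each $x$. A generalized group is abelian if $xy=yx$ for all its elements $x,y$, and non-abelian otherwise. A generalized subgroup of $G$ is a non-empty subset of $G$ that is closed under the operation of $G$ and is itself a generalized group under that operation. A groupoid is a non-empty set $L$ with a binary operation $\cdot$ such that $x\cdot y\in L$ for all $x,y\in L$. A Bol groupoid is a groupoid satisfying the Bol identity $((xy)z)y=x((yz)y)$ for all $x,y,z$. *)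

theory Defs
  imports Main
begin

locale groupoid =
  fixes L :: "'a set" and m :: "'a \<Rightarrow> 'a \<Rightarrow> 'a" (infixl \<open>\<cdot>\<close> 70)
  assumes nonempty: "L \<noteq> {}"
    and closed: "\<lbrakk>x \<in> L; y \<in> L\<rbrakk> \<Longrightarrow> x \<cdot> y \<in> L"

locale bol_groupoid = groupoid +
  assumes bol: "\<lbrakk>x \<in> L; y \<in> L; z \<in> L\<rbrakk> \<Longrightarrow>
    ((x \<cdot> y) \<cdot> z) \<cdot> y = x \<cdot> ((y \<cdot> z) \<cdot> y)"

text \<open>The local identity \<open>e(x)\<close> and the inverse of \<open>x\<close>. Both are meaningful only when
  \<open>(G, m)\<close> is a generalized group: the uniqueness of \<open>e(x)\<close> is then an axiom, and the
  uniqueness of the inverse a consequence of the axioms.\<close>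

definition gg_unit :: "'a set \<Rightarrow> ('a \<Rightarrow> 'a \<Rightarrow> 'a) \<Rightarrow> 'a \<Rightarrow> 'a" where
  "gg_unit G m x = (THE e. e \<in> G \<and> m x e = x \<and> m e x = x)"

definition gg_inv :: "'a set \<Rightarrow> ('a \<Rightarrow> 'a \<Rightarrow> 'a) \<Rightarrow> 'a \<Rightarrow> 'a" where
  "gg_inv G m x = (THE y. y \<in> G \<and> m x y = gg_unit G m x \<and> m y x = gg_unit G m x)"

locale generalized_group = groupoid G m
  for G :: "'a set" and m :: "'a \<Rightarrow> 'a \<Rightarrow> 'a" (infixl \<open>\<cdot>\<close> 70) +
  assumes assoc: "\<lbrakk>x \<in> G; y \<in> G; z \<in> G\<rbrakk> \<Longrightarrow> (x \<cdot> y) \<cdot> z = x \<cdot> (y \<cdot> z)"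
    and unit: "x \<in> G \<Longrightarrow> \<exists>!e. e \<in> G \<and> x \<cdot> e = x \<and> e \<cdot> x = x"
    and inverse: "x \<in> G \<Longrightarrow>
      \<exists>y. y \<in> G \<and> x \<cdot> y = gg_unit G m x \<and> y \<cdot> x = gg_unit G m x"

definition abelian_on :: "'a set \<Rightarrow> ('a \<Rightarrow> 'a \<Rightarrow> 'a) \<Rightarrow> bool" where
  "abelian_on G m \<longleftrightarrow> (\<forall>x\<in>G. \<forall>y\<in>G. m x y = m y x)"

text \<open>Non-emptiness and closure of \<open>H\<close> are part of \<open>generalized_group H m\<close>.\<close>

definition generalized_subgroup :: "'a set \<Rightarrow> 'a set \<Rightarrow> ('a \<Rightarrow> 'a \<Rightarrow> 'a) \<Rightarrow> bool" where
  "generalized_subgroup H G m \<longleftrightarrow> H \<subseteq> G \<and> generalized_group H m"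

end

theory Submission
  imports Defs
begin

text \<open>In an abelian generalized group, the local identities \<open>e(x)\<close> and \<open>e(y)\<close> both fix \<open>xy\<close>, hence
  coincide; so \<open>H\<close> is a group. With \<open>k = h\<^sub>2h\<^sub>3h\<^sub>2\<close>, the second component of the Bol identity
  reduces to \<open>k\<^sup>-\<^sup>1h\<^sub>2h\<^sub>3 = h\<^sub>2\<^sup>-\<^sup>1\<close>, which follows from \<open>h\<^sub>2h\<^sub>3 = kh\<^sub>2\<^sup>-\<^sup>1\<close>.\<close>

context generalized_group
begin

lemma gg_unit:
  assumes "x \<in> G"
  shows "gg_unit G m x \<in> G" "x \<cdot> gg_unit G m x = x" "gg_unit G m x \<cdot> x = x"
  using theI'[OF unit[OF assms]] unfolding gg_unit_def by auto

lemma gg_unit_eqI: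
  assumes "x \<in> G" "e \<in> G" "x \<cdot> e = x" "e \<cdot> x = x"
  shows "gg_unit G m x = e"
  using unit[OF assms(1)] gg_unit[OF assms(1)] assms by blast

text \<open>By associativity \<open>e(x)e(x)\<close> fixes \<open>x\<close> on both sides, so
  uniqueness of the local identity gives \<open>e(x)e(x) = e(x)\<close>. An idempotent is its own
  local identity.\<close>

lemma gg_unit_gg_unit:
  assumes "x \<in> G"
  shows "gg_unit G m (gg_unit G m x) = gg_unit G m x"
proof -
  let ?e = "gg_unit G m x"
  have "gg_unit G m x = ?e \<cdot> ?e"
    using assms gg_unit[OF assms]
    by (intro gg_unit_eqI) (simp_all add: closed assoc flip: assoc[of x ?e ?e])
  then show ?thesis
    using gg_unit[OF assms] by (intro gg_unit_eqI) simp_all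
qed

text \<open>Since \<open>e(x) = xy = yx\<close>, associativity lets \<open>e(x)\<close> absorb
  \<open>e(y)\<close> on either side. Thus \<open>e(y)\<close> is the local identity of
  \<open>e(x)\<close>, which is \<open>e(x)\<close> itself.\<close>

lemma gg_unit_inverse:
  assumes x: "x \<in> G" and y: "y \<in> G"
    and xy: "x \<cdot> y = gg_unit G m x" and yx: "y \<cdot> x = gg_unit G m x"
  shows "gg_unit G m y = gg_unit G m x"
proof -
  let ?e = "gg_unit G m x" and ?f = "gg_unit G m y"
  have "?e \<cdot> ?f = ?e"
    using assoc[OF x y gg_unit(1)[OF y]] xy gg_unit(2)[OF y] by simp
  moreover have "?f \<cdot> ?e = ?e"
    using assoc[OF gg_unit(1)[OF y] y x] yx gg_unit(3)[OF y] by simp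
  ultimately have "gg_unit G m ?e = ?f"
    using x y by (intro gg_unit_eqI gg_unit(1)) auto
  then show ?thesis
    using gg_unit_gg_unit[OF x] by simp
qed

text \<open>The group argument \<open>z = z(xy) = (zx)y = y\<close> carries over because
  \<open>x\<close> shares its local identity with each of its inverses. This makes the description
  in \<open>gg_inv\<close> well defined.\<close>

lemma gg_inv_eqI:
  assumes x: "x \<in> G" and y: "y \<in> G"
    and xy: "x \<cdot> y = gg_unit G m x" and yx: "y \<cdot> x = gg_unit G m x"
  shows "gg_inv G m x = y"
  unfolding gg_inv_def
proof (rule the_equality)
  fix z assume z: "z \<in> G \<and> x \<cdot> z = gg_unit G m x \<and> z \<cdot> x = gg_unit G m x"
  have "z = z \<cdot> (x \<cdot> y)"
    using z x xy gg_unit(2)[of z] gg_unit_inverse[of x z] by simp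
  also have "\<dots> = z \<cdot> x \<cdot> y"
    using assoc[of z x y] x y z by simp
  also have "\<dots> = y"
    using z x y gg_unit(3)[OF y] gg_unit_inverse[OF x y xy yx] by simp
  finally show "z = y" .
qed (use assms in auto)

lemma gg_inv:
  assumes "x \<in> G"
  shows "gg_inv G m x \<in> G" "x \<cdot> gg_inv G m x = gg_unit G m x" "gg_inv G m x \<cdot> x = gg_unit G m x"
    "gg_unit G m x \<cdot> gg_inv G m x = gg_inv G m x"
proof -
  obtain y where y: "y \<in> G" "x \<cdot> y = gg_unit G m x" "y \<cdot> x = gg_unit G m x"
    using inverse[OF assms] by blast
  then show "gg_inv G m x \<in> G" "x \<cdot> gg_inv G m x = gg_unit G m x"
    "gg_inv G m x \<cdot> x = gg_unit G m x" "gg_unit G m x \<cdot> gg_inv G m x = gg_inv G m x"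
    using gg_inv_eqI[OF assms y] gg_unit_inverse[OF assms y] gg_unit(3)[OF y(1)] by auto
qed

lemma gg_unit_eq_if_abelian:
  assumes "abelian_on G m" and x: "x \<in> G" and y: "y \<in> G"
  shows "gg_unit G m x = gg_unit G m y"
proof -
  have comm: "u \<cdot> v = v \<cdot> u" if "u \<in> G" "v \<in> G" for u v
    using assms(1) that by (auto simp: abelian_on_def)
  have "gg_unit G m (u \<cdot> v) = gg_unit G m u" if u: "u \<in> G" and v: "v \<in> G" for u v
  proof -
    let ?e = "gg_unit G m u"
    have "?e \<cdot> (u \<cdot> v) = u \<cdot> v"
      using assoc[OF gg_unit(1)[OF u] u v] gg_unit(3)[OF u] by simp
    then show ?thesis
      using u v comm gg_unit(1)[OF u] closed by (intro gg_unit_eqI) simp_all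
  qed
  then show ?thesis
    using x y comm by metis
qed

end

text \<open>The local identity taken in \<open>H\<close> lies in \<open>G\<close> and fixes
  \<open>x\<close>, so uniqueness in \<open>G\<close> applies. This links the commutativity argument
  inside \<open>H\<close> to \<open>gg_inv G m\<close>, which refers to the units of
  \<open>G\<close>.\<close>

lemma generalized_subgroup_gg_unit:
  assumes "generalized_group G m" and "generalized_subgroup H G m" and "x \<in> H"
  shows "gg_unit G m x = gg_unit H m x"
proof -
  interpret G: generalized_group G m by fact
  interpret H: generalized_group H m
    using assms(2) by (simp add: generalized_subgroup_def)
  show ?thesis
    using assms(2,3) H.gg_unit[OF assms(3)]
    by (intro G.gg_unit_eqI) (auto simp: generalized_subgroup_def)
qed

theorem corollary3p1:
  fixes G H :: "'a set" and m :: "'a \<Rightarrow> 'a \<Rightarrow> 'a" (infixl \<open>\<cdot>\<close> 70)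
  assumes "generalized_group G m"
    and "\<not> abelian_on G m"
    and "generalized_subgroup H G m"
    and "abelian_on H m"
  shows "bol_groupoid (H \<times> G)
    (\<lambda>(h1, g1) (h2, g2). (h1 \<cdot> h2, h2 \<cdot> g1 \<cdot> gg_inv G m h2 \<cdot> g2))"
proof -
  interpret G: generalized_group G m by fact
  interpret H: generalized_group H m
    using assms(3) by (simp add: generalized_subgroup_def)
  have sub: "x \<in> G" if "x \<in> H" for x
    using assms(3) that by (auto simp: generalized_subgroup_def)
  have unit_eq: "gg_unit G m x = gg_unit G m y" if "x \<in> H" "y \<in> H" for x y
  proof -
    have "gg_unit H m x = gg_unit H m y"
      using that assms(4) by (intro H.gg_unit_eq_if_abelian)
    then show ?thesis
      using that generalized_subgroup_gg_unit[OF assms(1,3)] by simp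
  qed
  have key: "gg_inv G m (b \<cdot> c \<cdot> b) \<cdot> (b \<cdot> c) = gg_inv G m b" if b: "b \<in> H" and c: "c \<in> H" for b c
  proof -
    let ?k = "b \<cdot> c \<cdot> b" and ?b = "gg_inv G m b"
    have k: "?k \<in> H"
      using b c by (simp add: H.closed)
    note inG = sub[OF b] sub[OF c] sub[OF k] G.gg_inv(1)[OF sub[OF b]] G.gg_inv(1)[OF sub[OF k]]
    have "?k \<cdot> ?b = b \<cdot> (c \<cdot> gg_unit G m b)"
      using inG by (simp add: G.assoc G.closed G.gg_inv(2))
    \<comment> \<open>All elements of \<open>H\<close> share one local identity, so \<open>c\<close>
      absorbs that of \<open>b\<close>.\<close>
    also have "\<dots> = b \<cdot> c"
      using unit_eq[OF b c] G.gg_unit(2)[OF inG(2)] by simp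
    finally have "gg_inv G m ?k \<cdot> (b \<cdot> c) = gg_inv G m ?k \<cdot> (?k \<cdot> ?b)"
      by simp
    also have "\<dots> = gg_inv G m ?k \<cdot> ?k \<cdot> ?b"
      using G.assoc[OF inG(5,3,4)] by simp
    \<comment> \<open>The product \<open>?i k\<close> times \<open>k\<close> leaves the local
      identity of \<open>k\<close>, which is that of \<open>b\<close> and hence fixes the inverse of
      \<open>b\<close>.\<close>
    also have "\<dots> = ?b"
      using G.gg_inv(3)[OF inG(3)] unit_eq[OF k b] G.gg_inv(4)[OF inG(1)] by simp
    finally show ?thesis .
  qed
  show ?thesis
  proof
    show "H \<times> G \<noteq> {}"
      using H.nonempty G.nonempty by simp
  next
    fix x y assume "x \<in> H \<times> G" "y \<in> H \<times> G"
    then show "(case x of (h1, g1) \<Rightarrow> \<lambda>(h2, g2). (h1 \<cdot> h2, h2 \<cdot> g1 \<cdot> gg_inv G m h2 \<cdot> g2)) y \<in> H \<times> G"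
      by (auto simp: H.closed G.closed G.gg_inv(1) sub)
  next
    fix x y z assume "x \<in> H \<times> G" "y \<in> H \<times> G" "z \<in> H \<times> G"
    then obtain a p b q c r where xyz: "x = (a, p)" "y = (b, q)" "z = (c, r)"
      and H: "a \<in> H" "b \<in> H" "c \<in> H" and G: "p \<in> G" "q \<in> G" "r \<in> G"
      by auto
    let ?i = "gg_inv G m" and ?k = "b \<cdot> c \<cdot> b"
    note inG = sub[OF H(1)] sub[OF H(2)] sub[OF H(3)] G
    have invG: "?i b \<in> G" "?i c \<in> G" "?i ?k \<in> G"
      using inG by (simp_all add: G.closed G.gg_inv(1))
    \<comment> \<open>This is the second component of \<open>((xy)z)y\<close>; the chain ends at
      that of \<open>x((yz)y)\<close>. Only the leftmost \<open>?i b\<close> must change: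
      \<open>key\<close>, read from right to left, expands it.\<close>
    have "b \<cdot> (c \<cdot> (b \<cdot> p \<cdot> ?i b \<cdot> q) \<cdot> ?i c \<cdot> r) \<cdot> ?i b \<cdot> q
        = ?k \<cdot> p \<cdot> ?i b \<cdot> (q \<cdot> ?i c \<cdot> r \<cdot> ?i b \<cdot> q)"
      using inG invG by (simp add: G.assoc G.closed)
    also have "\<dots> = ?k \<cdot> p \<cdot> (?i ?k \<cdot> (b \<cdot> c)) \<cdot> (q \<cdot> ?i c \<cdot> r \<cdot> ?i b \<cdot> q)"
      by (simp only: key[OF H(2,3)])
    also have "\<dots> = ?k \<cdot> p \<cdot> ?i ?k \<cdot> (b \<cdot> (c \<cdot> q \<cdot> ?i c \<cdot> r) \<cdot> ?i b \<cdot> q)"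
    proof -
      \<comment> \<open>Naming the inverse keeps \<open>?k\<close> hidden, so that reassociation
        does not rewrite the argument of \<open>gg_inv\<close>.\<close>
      define j where "j = ?i ?k"
      have "j \<in> G" using invG(3) by (simp add: j_def)
      then show ?thesis
        unfolding j_def[symmetric] using inG invG(1,2) by (simp add: G.assoc G.closed)
    qed
    finally show "(case (case (case x of (h1, g1) \<Rightarrow> \<lambda>(h2, g2). (h1 \<cdot> h2, h2 \<cdot> g1 \<cdot> ?i h2 \<cdot> g2)) y of
          (h1, g1) \<Rightarrow> \<lambda>(h2, g2). (h1 \<cdot> h2, h2 \<cdot> g1 \<cdot> ?i h2 \<cdot> g2)) z of
          (h1, g1) \<Rightarrow> \<lambda>(h2, g2). (h1 \<cdot> h2, h2 \<cdot> g1 \<cdot> ?i h2 \<cdot> g2)) y =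
        (case x of (h1, g1) \<Rightarrow> \<lambda>(h2, g2). (h1 \<cdot> h2, h2 \<cdot> g1 \<cdot> ?i h2 \<cdot> g2))
          ((case (case y of (h1, g1) \<Rightarrow> \<lambda>(h2, g2). (h1 \<cdot> h2, h2 \<cdot> g1 \<cdot> ?i h2 \<cdot> g2)) z of
            (h1, g1) \<Rightarrow> \<lambda>(h2, g2). (h1 \<cdot> h2, h2 \<cdot> g1 \<cdot> ?i h2 \<cdot> g2)) y)"
      \<comment> \<open>The first components agree by associativity in \<open>H\<close>; the second
        ones are the chain above.\<close>
      using H by (simp add: xyz H.assoc H.closed)
  qed
qed

end
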